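(* Let $1<p<\infty$ and let $T\in\mathcal L(\ell_p^2)$ have the matrix representation $$T=\begin{pmatrix} a & b\\ 0 & d\end{pmatrix}$$ with $a,b,d\in\mathbb C$. Then $W(T)$ is star-shaped with centre $\dfrac{\operatorname{tr}T}{2}=\dfrac{a+d}{2}$.
   Context: $\ell_p^2$ is $\mathbb C^2$ with the $\|\cdot\|_p$-norm; matrices are identified with operators with respect to the standard basis. With $1/p+1/q=1$, the dual of $\ell_p^2$ is identified with $\ell_q^2$ via $\langle x,y\rangle=\sum_{j} x_j\overline{y_j}$. For $x=(x_1,x_2)$ put $J(x)=(x_j|x_j|^{p-2})_j$ (with $0$ in the coordinates where $x_j=0$). The numerical range is $W(T)=\{\langle Tx,J(x)\rangle:\ x\in\ell_p^2,\ \|x\|_p=1\}$. A set $A\subset\mathbb C$ is star-shaped with centre $c\in A$ if $(1-t)c+tz\in A$ for all $z\in A$ and $t\in[0,1]$. *)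

theory Defs
  imports "HOL-Analysis.Analysis"
begin

definition lp_norm :: "real \<Rightarrow> complex ^ 2 \<Rightarrow> real" where
  "lp_norm p x = (\<Sum>j\<in>UNIV. cmod (x $ j) powr p) powr (1 / p)"

definition lp_pairing :: "complex ^ 2 \<Rightarrow> complex ^ 2 \<Rightarrow> complex" where
  "lp_pairing x y = (\<Sum>j\<in>UNIV. x $ j * cnj (y $ j))"

definition duality_map :: "real \<Rightarrow> complex ^ 2 \<Rightarrow> complex ^ 2" where
  "duality_map p x =
     (\<chi> j. if x $ j = 0 then 0 else x $ j * of_real (cmod (x $ j) powr (p - 2)))"

text \<open>An operator on the two-dimensional complex \<open>l_p\<close> space is given by its matrix in the
  standard basis; the entry in row \<open>i\<close> and column \<open>j\<close> is \<open>T $ i $ j\<close>.\<close>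

definition numerical_range :: "real \<Rightarrow> complex ^ 2 ^ 2 \<Rightarrow> complex set" where
  "numerical_range p T = {lp_pairing (T *v x) (duality_map p x) | x. lp_norm p x = 1}"

text \<open>The library predicate \<open>starlike\<close> leaves the centre existentially quantified, so the
  version with a prescribed centre is defined here.\<close>

definition star_shaped_with_centre :: "complex set \<Rightarrow> complex \<Rightarrow> bool" where
  "star_shaped_with_centre A c \<longleftrightarrow>
     c \<in> A \<and> (\<forall>z\<in>A. \<forall>t::real. 0 \<le> t \<and> t \<le> 1 \<longrightarrow> of_real (1 - t) * c + of_real t * z \<in> A)"

end

theory Submission
  imports Defs
begin

text \<open>
  Write a unit vector as \<open>x\<close> with \<open>u = \<bar>x\<^sub>1\<bar>\<^sup>p\<close>, so that \<open>\<bar>x\<^sub>2\<bar>\<^sup>p = 1 - u\<close>. The diagonal part of \<open>T\<close>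
  contributes \<open>u a + (1 - u) d\<close> to \<open>\<langle>Tx, J x\<rangle>\<close>, and the corner entry contributes a number of modulus
  \<open>\<bar>b\<bar> r(u)\<close> with \<open>r(u) = u\<^bsup>1 - 1/p\<^esup> (1 - u)\<^bsup>1/p\<^esup>\<close>, whose argument is arbitrary because the phase of
  \<open>x\<^sub>2\<close> is free. Hence the numerical range is a union of circles whose centres run through the
  segment from \<open>d\<close> to \<open>a\<close>.

  The radius vanishes at both ends of the segment, so a point inside one of the circles is outside,
  or on, each of the two degenerate end circles. Moving the circle continuously from the one
  position to the other, it must meet the point. The union of the circles is therefore also the
  union of the closed discs that they bound
  (\<open>numerical_range_upper_triangular_eq_discs\<close>).

  A weighted geometric mean is concave, so \<open>r\<close> is concave, and a union of discs whose centre
  depends affinely and whose radius depends concavely on the parameter is convex. The numerical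
  range is thus even convex, and it contains \<open>(a + d)/2\<close>, the centre of the disc at \<open>u = 1/2\<close>. A
  convex set is star-shaped with respect to each of its points.
\<close>

section \<open>Concavity of the weighted geometric mean\<close>

text \<open>By homogeneity the sums \<open>x + x'\<close> and \<open>y + y'\<close> may be normalised to \<open>1\<close>; each term on the left is then
  bounded by Young's inequality, and the arithmetic means add up to \<open>1\<close>. This is Hoelder's
  inequality for sums of two terms.\<close>

lemma weighted_geometric_mean_superadditive:
  fixes x y x' y' \<alpha> \<beta> :: real
  assumes "0 < \<alpha>" "0 < \<beta>" "\<alpha> + \<beta> = 1"
    and nonneg: "0 \<le> x" "0 \<le> y" "0 \<le> x'" "0 \<le> y'"
  shows "x powr \<alpha> * y powr \<beta> + x' powr \<alpha> * y' powr \<beta> \<le> (x + x') powr \<alpha> * (y + y') powr \<beta>"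
proof (cases "x + x' = 0 \<or> y + y' = 0")
  case True
  then have "x = 0 \<and> x' = 0 \<or> y = 0 \<and> y' = 0"
    using nonneg by linarith
  then show ?thesis by auto
next
  case False
  define X Y where "X = x + x'" and "Y = y + y'"
  have pos: "0 < X" "0 < Y"
    using False nonneg by (auto simp: X_def Y_def)
  have normalised: "s powr \<alpha> * t powr \<beta> \<le> (\<alpha> * (s / X) + \<beta> * (t / Y)) * (X powr \<alpha> * Y powr \<beta>)"
    if "0 \<le> s" "0 \<le> t" for s t
  proof -
    have young: "(s / X) powr \<alpha> * (t / Y) powr \<beta> \<le> \<alpha> * (s / X) + \<beta> * (t / Y)"
    proof (cases "s = 0 \<or> t = 0")
      case True
      have "0 \<le> \<alpha> * (s / X) + \<beta> * (t / Y)"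
        using assms(1,2) pos that by simp
      with True show ?thesis by auto
    next
      case False
      then show ?thesis
        using assms(1-3) pos that by (intro Youngs_inequality_0) auto
    qed
    have "s powr \<alpha> * t powr \<beta> = (s / X) powr \<alpha> * (t / Y) powr \<beta> * (X powr \<alpha> * Y powr \<beta>)"
      using pos that by (simp add: powr_divide)
    also have "\<dots> \<le> (\<alpha> * (s / X) + \<beta> * (t / Y)) * (X powr \<alpha> * Y powr \<beta>)"
      using young by (rule mult_right_mono) simp
    finally show ?thesis .
  qed
  have "x powr \<alpha> * y powr \<beta> + x' powr \<alpha> * y' powr \<beta>
        \<le> (\<alpha> * (x / X) + \<beta> * (y / Y) + (\<alpha> * (x' / X) + \<beta> * (y' / Y))) * (X powr \<alpha> * Y powr \<beta>)"
    using normalised[of x y] normalised[of x' y'] nonneg by (simp add: distrib_right)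
  also have "\<alpha> * (x / X) + \<beta> * (y / Y) + (\<alpha> * (x' / X) + \<beta> * (y' / Y))
             = \<alpha> * ((x + x') / X) + \<beta> * ((y + y') / Y)"
    by (simp add: add_divide_distrib algebra_simps)
  also have "\<dots> = 1"
    using pos assms(3) by (simp flip: X_def Y_def)
  finally show ?thesis by (simp add: X_def Y_def)
qed

text \<open>The radius, for \<open>b = 1\<close>, of the circle traced by \<open>\<langle>Tx, J x\<rangle>\<close> when the moduli are fixed by
  \<open>\<bar>x\<^sub>1\<bar>\<^sup>p = u\<close> and \<open>\<bar>x\<^sub>2\<bar>\<^sup>p = 1 - u\<close> and only the phases vary.\<close>

definition circle_radius :: "real \<Rightarrow> real \<Rightarrow> real" where
  "circle_radius p u = u powr (1 - 1 / p) * (1 - u) powr (1 / p)"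

lemma circle_radius_nonneg: "0 \<le> circle_radius p u"
  by (simp add: circle_radius_def)

lemma circle_radius_1: "circle_radius p 1 = 0"
  by (simp add: circle_radius_def)

lemma continuous_on_circle_radius:
  assumes "1 < p"
  shows "continuous_on {0..1} (circle_radius p)"
  unfolding circle_radius_def using assms
  by (intro continuous_on_mult continuous_on_powr' continuous_intros) auto

text \<open>The weighted geometric mean is homogeneous of degree \<open>1\<close>, so the weights \<open>1 - t\<close> and \<open>t\<close> can be
  moved into its arguments, and superadditivity gives concavity.\<close>

lemma circle_radius_concave:
  assumes "1 < p" "u \<in> {0..1}" "v \<in> {0..1}" "t \<in> {0..1}"
  shows "(1 - t) * circle_radius p u + t * circle_radius p v
         \<le> circle_radius p ((1 - t) * u + t * v)"
proof -
  let ?\<alpha> = "1 - 1 / p" and ?\<beta> = "1 / p"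
  have scale: "s * circle_radius p w = (s * w) powr ?\<alpha> * (s * (1 - w)) powr ?\<beta>"
    if "0 \<le> s" "w \<in> {0..1}" for s w
  proof -
    have "s powr ?\<alpha> * s powr ?\<beta> = s"
      using that by (simp flip: powr_add)
    then show ?thesis
      using that by (simp add: circle_radius_def powr_mult mult_ac)
  qed
  have "(1 - t) * circle_radius p u + t * circle_radius p v
        \<le> ((1 - t) * u + t * v) powr ?\<alpha> * ((1 - t) * (1 - u) + t * (1 - v)) powr ?\<beta>"
    using assms by (simp add: scale) (rule weighted_geometric_mean_superadditive, auto)
  also have "(1 - t) * (1 - u) + t * (1 - v) = 1 - ((1 - t) * u + t * v)"
    by (simp add: algebra_simps)
  finally show ?thesis by (simp add: circle_radius_def)
qed

section \<open>The numerical range as a union of circles\<close>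

lemma lp_norm_eq_1_iff:
  assumes "0 < p"
  shows "lp_norm p x = 1 \<longleftrightarrow> cmod (x $ 1) powr p + cmod (x $ 2) powr p = 1"
proof -
  have "s powr (1 / p) = 1 \<longleftrightarrow> s = 1" if "0 \<le> s" for s :: real
    using assms that by (cases "s = 0 \<or> s = 1") auto
  then show ?thesis by (simp add: lp_norm_def sum_2)
qed

lemma pairing_duality_map_upper_triangular:
  assumes "T = vector [vector [a, b], vector [0, d]]"
  shows "lp_pairing (T *v x) (duality_map p x) =
           of_real (cmod (x $ 1) powr p) * a + of_real (cmod (x $ 2) powr p) * d
           + b * x $ 2 * cnj (x $ 1) * of_real (cmod (x $ 1) powr (p - 2))"
proof -
  have J: "duality_map p x $ j = x $ j * of_real (cmod (x $ j) powr (p - 2))" for j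
    by (simp add: duality_map_def)
  have diagonal: "w * cnj w * of_real (cmod w powr (p - 2)) = of_real (cmod w powr p)" for w
  proof (cases "w = 0")
    case False
    then have "cmod w ^ 2 * cmod w powr (p - 2) = cmod w powr p"
      by (simp flip: powr_numeral powr_add)
    then show ?thesis
      by (metis complex_norm_square of_real_mult)
  qed simp
  have "lp_pairing (T *v x) (duality_map p x) =
          (x $ 1 * cnj (x $ 1) * of_real (cmod (x $ 1) powr (p - 2))) * a
          + (x $ 2 * cnj (x $ 2) * of_real (cmod (x $ 2) powr (p - 2))) * d
          + b * x $ 2 * cnj (x $ 1) * of_real (cmod (x $ 1) powr (p - 2))"
    by (simp add: lp_pairing_def assms sum_2 matrix_vector_mult_def J algebra_simps)
  then show ?thesis by (simp only: diagonal)
qed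

lemma powr_diff_mult_self:
  fixes r p :: real
  assumes "0 \<le> r"
  shows "r * r powr (p - 2) = r powr (p - 1)"
  using assms by (cases "r = 0") (simp_all add: powr_mult_base)

text \<open>The corner term has modulus \<open>\<bar>b\<bar> \<bar>x\<^sub>2\<bar> \<bar>x\<^sub>1\<bar>\<^bsup>p - 1\<^esup>\<close>, which is \<open>\<bar>b\<bar>\<close> times the radius at
  \<open>u = \<bar>x\<^sub>1\<bar>\<^sup>p\<close>. Conversely, a point of a circle is reached by a vector with \<open>x\<^sub>1 \<ge> 0\<close>, the phase of
  \<open>x\<^sub>2\<close> being read off from the position of the point on its circle.\<close>

lemma numerical_range_upper_triangular_eq_circles:
  assumes "1 < p" and T: "T = vector [vector [a, b], vector [0, d]]"
  shows "numerical_range p T =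
           (\<Union>u\<in>{0..1}. sphere (of_real u * a + of_real (1 - u) * d) (cmod b * circle_radius p u))"
    (is "_ = (\<Union>u\<in>{0..1}. sphere (?c u) _)")
proof (intro equalityI subsetI)
  fix z assume "z \<in> numerical_range p T"
  then obtain x where z: "z = lp_pairing (T *v x) (duality_map p x)" and "lp_norm p x = 1"
    by (auto simp: numerical_range_def)
  define u where "u = cmod (x $ 1) powr p"
  have x2: "cmod (x $ 2) powr p = 1 - u"
    using \<open>lp_norm p x = 1\<close> assms(1) by (simp add: lp_norm_eq_1_iff u_def)
  have "0 \<le> u" "0 \<le> 1 - u"
    by (simp add: u_def) (simp flip: x2)
  have "u powr (1 - 1 / p) = cmod (x $ 1) powr (p - 1)"
    using assms(1) by (simp add: u_def powr_powr right_diff_distrib)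
  moreover have "(1 - u) powr (1 / p) = cmod (x $ 2)"
    using assms(1) by (simp add: powr_powr flip: x2)
  ultimately have "cmod (z - ?c u) = cmod b * circle_radius p u"
    unfolding z pairing_duality_map_upper_triangular[OF T]
    by (simp add: x2 circle_radius_def norm_mult powr_diff_mult_self flip: u_def)
  with \<open>0 \<le> u\<close> \<open>0 \<le> 1 - u\<close>
  show "z \<in> (\<Union>u\<in>{0..1}. sphere (?c u) (cmod b * circle_radius p u))"
    by (auto simp: dist_norm norm_minus_commute)
next
  fix z assume "z \<in> (\<Union>u\<in>{0..1}. sphere (?c u) (cmod b * circle_radius p u))"
  then obtain u where u: "0 \<le> u" "u \<le> 1" and z: "cmod (z - ?c u) = cmod b * circle_radius p u"
    by (auto simp: dist_norm norm_minus_commute)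
  obtain \<omega> where \<omega>: "cmod \<omega> = 1" "b * \<omega> * of_real (circle_radius p u) = z - ?c u"
  proof (cases "b * of_real (circle_radius p u) = 0")
    case True
    \<comment> \<open>The circle is a point, and every phase gives it.\<close>
    then have "z - ?c u = 0" using z by auto
    with True show thesis by (intro that[of 1]) auto
  next
    case False
    then show thesis
      using z circle_radius_nonneg[of p u]
      by (intro that[of "(z - ?c u) / (b * of_real (circle_radius p u))"])
        (simp_all add: norm_divide norm_mult)
  qed
  define x :: "complex ^ 2" where
    "x = vector [of_real (u powr (1 / p)), \<omega> * of_real ((1 - u) powr (1 / p))]"
  have x: "x $ 1 = of_real (u powr (1 / p))" "x $ 2 = \<omega> * of_real ((1 - u) powr (1 / p))"
    by (simp_all add: x_def)
  have powers: "cmod (x $ 1) powr p = u" "cmod (x $ 2) powr p = 1 - u"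
    using u assms(1) \<omega>(1) by (simp_all add: x norm_mult powr_powr)
  have "cnj (x $ 1) * of_real (cmod (x $ 1) powr (p - 2))
        = of_real (u powr (1 / p) * (u powr (1 / p)) powr (p - 2))"
    by (simp add: x)
  also have "u powr (1 / p) * (u powr (1 / p)) powr (p - 2) = u powr (1 - 1 / p)"
    using assms(1) by (subst powr_diff_mult_self) (simp_all add: powr_powr right_diff_distrib)
  finally have "b * x $ 2 * cnj (x $ 1) * of_real (cmod (x $ 1) powr (p - 2))
                = b * \<omega> * of_real (circle_radius p u)"
    by (simp add: x(2) circle_radius_def mult_ac)
  then have "z = lp_pairing (T *v x) (duality_map p x)"
    unfolding pairing_duality_map_upper_triangular[OF T] powers by (simp add: \<omega>(2))
  moreover have "lp_norm p x = 1"
    using assms(1) by (simp add: lp_norm_eq_1_iff powers)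
  ultimately show "z \<in> numerical_range p T"
    by (auto simp: numerical_range_def)
qed

section \<open>Filling the circles, and convexity\<close>

text \<open>The signed distance from a point of the disc at \<open>u\<close> to the circle at \<open>v\<close> is at most \<open>0\<close> for
  \<open>v = u\<close> and at least \<open>0\<close> for \<open>v = 1\<close>, where the circle is a point. By the intermediate value
  theorem it vanishes for some \<open>v\<close> in between.\<close>

lemma numerical_range_upper_triangular_eq_discs:
  assumes "1 < p" and T: "T = vector [vector [a, b], vector [0, d]]"
  shows "numerical_range p T =
           (\<Union>u\<in>{0..1}. cball (of_real u * a + of_real (1 - u) * d) (cmod b * circle_radius p u))"
    (is "_ = (\<Union>u\<in>{0..1}. cball (?c u) (?r u))")
proof -
  have "\<exists>v\<in>{0..1}. z \<in> sphere (?c v) (?r v)" if "u \<in> {0..1}" "z \<in> cball (?c u) (?r u)" for u z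
  proof -
    define gap where "gap v = dist (?c v) z - ?r v" for v
    have "continuous_on {0..1} gap"
      unfolding gap_def
      by (intro continuous_intros continuous_on_circle_radius assms(1))
    then have "continuous_on {u..1} gap"
      by (rule continuous_on_subset) (use that in auto)
    moreover have "u \<le> 1" "gap u \<le> 0" "0 \<le> gap 1"
      using that by (simp_all add: gap_def circle_radius_1)
    ultimately obtain v where "u \<le> v" "v \<le> 1" "gap v = 0"
      using IVT'[of gap u 0 1] by blast
    then show ?thesis
      using that by (intro bexI[of _ v]) (auto simp: gap_def)
  qed
  then have "(\<Union>u\<in>{0..1}. cball (?c u) (?r u)) \<subseteq> (\<Union>u\<in>{0..1}. sphere (?c u) (?r u))"
    by (intro UN_least subsetI) (simp only: UN_iff)
  moreover have "(\<Union>u\<in>{0..1}. sphere (?c u) (?r u)) \<subseteq> (\<Union>u\<in>{0..1}. cball (?c u) (?r u))"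
    by (intro UN_mono subset_refl sphere_cball)
  ultimately show ?thesis
    unfolding numerical_range_upper_triangular_eq_circles[OF assms] by (rule equalityI[rotated])
qed

text \<open>A convex combination of points of the discs at \<open>u\<close> and \<open>v\<close> lies within the same combination of
  the two radii of the corresponding point of the segment of centres. By concavity that bound does
  not exceed the radius there.\<close>

lemma convex_numerical_range_upper_triangular:
  assumes "1 < p" and T: "T = vector [vector [a, b], vector [0, d]]"
  shows "convex (numerical_range p T)"
proof -
  let ?c = "\<lambda>u. of_real u * a + of_real (1 - u) * d"
  let ?r = "\<lambda>u. cmod b * circle_radius p u"
  have combination:
    "(1 - t) *\<^sub>R y + t *\<^sub>R z \<in> cball (?c ((1 - t) * u + t * v)) (?r ((1 - t) * u + t * v))"
    if "u \<in> {0..1}" "v \<in> {0..1}" "t \<in> {0..1}" "y \<in> cball (?c u) (?r u)" "z \<in> cball (?c v) (?r v)"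
    for u v t y z
  proof -
    have "?c ((1 - t) * u + t * v) - ((1 - t) *\<^sub>R y + t *\<^sub>R z)
          = (1 - t) *\<^sub>R (?c u - y) + t *\<^sub>R (?c v - z)"
      by (simp add: scaleR_conv_of_real algebra_simps)
    also have "cmod \<dots> \<le> cmod ((1 - t) *\<^sub>R (?c u - y)) + cmod (t *\<^sub>R (?c v - z))"
      by (rule norm_triangle_ineq)
    also have "\<dots> = (1 - t) * cmod (?c u - y) + t * cmod (?c v - z)"
      using that(3) by simp
    also have "\<dots> \<le> (1 - t) * ?r u + t * ?r v"
      using that(3-5) by (intro add_mono mult_left_mono) (auto simp: dist_norm)
    also have "\<dots> = cmod b * ((1 - t) * circle_radius p u + t * circle_radius p v)"
      by (simp add: algebra_simps)
    also have "\<dots> \<le> ?r ((1 - t) * u + t * v)"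
      using circle_radius_concave[OF assms(1) that(1-3)] by (rule mult_left_mono) simp
    finally show ?thesis by (simp add: dist_norm)
  qed
  show ?thesis
    unfolding numerical_range_upper_triangular_eq_discs[OF assms] convex_alt
  proof (intro ballI allI impI)
    fix y z and t :: real
    assume "y \<in> (\<Union>u\<in>{0..1}. cball (?c u) (?r u))" "z \<in> (\<Union>u\<in>{0..1}. cball (?c u) (?r u))"
      and "0 \<le> t \<and> t \<le> 1"
    then obtain u v where uv: "u \<in> {0..1}" "y \<in> cball (?c u) (?r u)"
        "v \<in> {0..1}" "z \<in> cball (?c v) (?r v)" and t: "t \<in> {0..1}"
      by (elim UN_E) (simp only: atLeastAtMost_iff)
    have "(1 - t) * u + t * v \<in> {0..1}"
      using convexD_alt[OF convex_real_interval(5)[of 0 1] uv(1,3), of t] t by simp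
    then show "(1 - t) *\<^sub>R y + t *\<^sub>R z \<in> (\<Union>u\<in>{0..1}. cball (?c u) (?r u))"
      using combination[OF uv(1,3) t uv(2,4)] by (rule UN_I)
  qed
qed

lemma convex_imp_star_shaped_with_centre:
  assumes "convex A" "c \<in> A"
  shows "star_shaped_with_centre A c"
  unfolding star_shaped_with_centre_def
proof (intro conjI ballI allI impI)
  fix z and t :: real assume "z \<in> A" "0 \<le> t \<and> t \<le> 1"
  then show "of_real (1 - t) * c + of_real t * z \<in> A"
    using convexD_alt[OF assms, of z t] by (simp only: scaleR_conv_of_real)
qed (rule assms(2))

theorem proposition2p8:
  fixes p :: real and a b d :: complex and T :: "complex ^ 2 ^ 2"
  assumes "1 < p"
    and "T = vector [vector [a, b], vector [0, d]]"
  shows "trace T / 2 = (a + d) / 2 \<and>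
         star_shaped_with_centre (numerical_range p T) (trace T / 2)"
proof
  show tr: "trace T / 2 = (a + d) / 2"
    by (simp add: trace_def sum_2 assms(2))
  have "(a + d) / 2 \<in> cball (of_real (1/2) * a + of_real (1 - 1/2) * d)
                            (cmod b * circle_radius p (1/2))"
    by (simp add: circle_radius_nonneg add_divide_distrib)
  then have "trace T / 2 \<in> numerical_range p T"
    unfolding tr numerical_range_upper_triangular_eq_discs[OF assms]
    by (intro UN_I[of "1/2"]) simp_all
  with convex_numerical_range_upper_triangular[OF assms]
  show "star_shaped_with_centre (numerical_range p T) (trace T / 2)"
    by (rule convex_imp_star_shaped_with_centre)
qed

end
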